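(* Let $(T_n,\rho_n)$ satisfy $T_n\to\infty$, $\rho_n\to0$ and $\rho_n^{-1}=o(n^2)$ as $n\to\infty$, and let $P_{1,n}=P_1(n,T_n,\rho_n)$ and $P_{0,n}=P_0(n,T_n,\rho_n)$ be the corresponding multi-layer stochastic block model sequences. Assume the low-degree polynomial conjecture (stated in the context). If $$n\,T_n^{1/2}\rho_n\le \tfrac12(\log n)^{-1.4}\quad\text{for all } n \text{ large enough},$$ then $P_{1,n}$ and $P_{0,n}$ are not distinguishable by any polynomial-time algorithm.
   Context: Throughout, $n$ and $T$ are even positive integers, $[m]=\{1,\dots,m\}$, and for even $m$, $\mathcal S_m=\{\boldsymbol\sigma\in\{0,1\}^m:\sum_{i\in[m]}\sigma(i)=m/2\}$. For $\rho\in(0,2/3)$ let $B^{(0)}$ and $B^{(1)}$ be the symmetric $2\times 2$ matrices with rows and columns indexed by $\{0,1\}$: $B^{(0)}$ has diagonal entries $\frac32\rho$ and off-diagonal entries $\frac12\rho$; $B^{(1)}$ has diagonal entries $\frac12\rho$ and off-diagonal entries $\frac32\rho$. Model $P_1(n,T,\rho)$: the joint law of $(\mathbf A,\boldsymbol\sigma,\boldsymbol\tau)$ where $\boldsymbol\sigma\sim\mathrm{Uniform}(\mathcal S_n)$ and $\boldsymbol\tau\sim\mathrm{Uniform}(\mathcal S_T)$ are independent and, given $(\boldsymbol\sigma,\boldsymbol\tau)$, the entries $A_t(i,j)$, $1\le i<j\le n$, $t\in[T]$, of $\mathbf A$ are independent with $A_t(i,j)\sim\mathrm{Bernoulli}(B^{(\tau(t))}(\sigma(i),\sigma(j)))$.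 Model $P_0(n,T,\rho)$: the $A_t(i,j)$ are i.i.d. $\mathrm{Bernoulli}(\rho)$. Only $\mathbf A$ is observed. Distinguishable: there is a sequence of tests $\hat\psi(\mathbf A)\in\{0,1\}$ with $P_{1,n}(\hat\psi(\mathbf A)=0)+P_{0,n}(\hat\psi(\mathbf A)=1)\to0$; distinguishable by a polynomial-time algorithm means that such a test can be computed in time polynomial in $n$. Low-degree polynomial conjecture: let $(T_n,\rho_n)$ satisfy $T_n\to\infty$, $\rho_n\to0$, $\rho_n^{-1}=o(n^2)$ as $n\to\infty$, and let $P_{0,n}=P_0(n,T_n,\rho_n)$, $P_{1,n}=P_1(n,T_n,\rho_n)$. If every polynomial $\psi$ in the $\binom n2 T_n$ entries of $\mathbf A$ of degree at most $D_n=\log^{1.01}(n)$ with $\mathbb E_{P_{0,n}}\psi^2=1$ and $\mathbb E_{P_{0,n}}\psi=0$ satisfies $\mathbb E_{P_{1,n}}\psi=O(1)$ uniformly, then $P_{1,n}$ is not distinguishable from $P_{0,n}$ by any polynomial-time algorithm. *)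

theory Defs
  imports
    "HOL-Probability.Product_PMF"
    "HOL-Library.Poly_Mapping"
    "HOL-Library.Landau_Symbols"
    "HOL-Computational_Algebra.Polynomial"
begin

subsection \<open>The multi-layer stochastic block model\<close>

definition balanced :: "nat \<Rightarrow> (nat \<Rightarrow> nat) set" where
  "balanced m = {\<sigma> \<in> {1..m} \<rightarrow>\<^sub>E {0, 1}. (\<Sum>i\<in>{1..m}. \<sigma> i) = m div 2}"

text \<open>\<open>block_prob \<rho> k a b\<close> is the entry of \<open>B\<close> with superscript \<open>k\<close> at row \<open>a\<close>, column \<open>b\<close>;
  all three labels are 0 or 1.\<close>

definition block_prob :: "real \<Rightarrow> nat \<Rightarrow> nat \<Rightarrow> nat \<Rightarrow> real" where
  "block_prob \<rho> k a b =
     (if k = 0 then (if a = b then 3/2 * \<rho> else 1/2 * \<rho>)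
      else (if a = b then 1/2 * \<rho> else 3/2 * \<rho>))"

text \<open>An entry of the observation is addressed by \<open>(i, j, t)\<close>: vertices \<open>i < j\<close> and layer \<open>t\<close>.
  The value \<open>True\<close> stands for 1. Entries outside \<open>entries n T\<close> are \<open>False\<close> almost surely.\<close>

type_synonym entry = "nat \<times> nat \<times> nat"
type_synonym tensor = "entry \<Rightarrow> bool"

definition entries :: "nat \<Rightarrow> nat \<Rightarrow> entry set" where
  "entries n T = {(i, j, t). 1 \<le> i \<and> i < j \<and> j \<le> n \<and> 1 \<le> t \<and> t \<le> T}"

definition P1_joint ::
    "nat \<Rightarrow> nat \<Rightarrow> real \<Rightarrow> (tensor \<times> (nat \<Rightarrow> nat) \<times> (nat \<Rightarrow> nat)) pmf" where
  "P1_joint n T \<rho> =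
     bind_pmf (pmf_of_set (balanced n)) (\<lambda>\<sigma>.
     bind_pmf (pmf_of_set (balanced T)) (\<lambda>\<tau>.
     map_pmf (\<lambda>A. (A, \<sigma>, \<tau>))
       (Pi_pmf (entries n T) False
         (\<lambda>(i, j, t). bernoulli_pmf (block_prob \<rho> (\<tau> t) (\<sigma> i) (\<sigma> j))))))"

definition P1 :: "nat \<Rightarrow> nat \<Rightarrow> real \<Rightarrow> tensor pmf" where
  "P1 n T \<rho> = map_pmf fst (P1_joint n T \<rho>)"

definition P0 :: "nat \<Rightarrow> nat \<Rightarrow> real \<Rightarrow> tensor pmf" where
  "P0 n T \<rho> = Pi_pmf (entries n T) False (\<lambda>_. bernoulli_pmf \<rho>)"

text \<open>Only even \<open>n\<close> occur in the model, so every limit in \<open>n\<close> is taken along this filter, and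
  the values of a parameter sequence at odd \<open>n\<close> are irrelevant.\<close>

definition even_at_top :: "nat filter" where
  "even_at_top = inf sequentially (principal {n. even n})"

definition admissible :: "(nat \<Rightarrow> nat) \<Rightarrow> (nat \<Rightarrow> real) \<Rightarrow> bool" where
  "admissible T \<rho> \<longleftrightarrow>
     (\<forall>n. even n \<and> 0 < n \<longrightarrow> even (T n) \<and> 0 < T n \<and> 0 < \<rho> n \<and> \<rho> n < 2/3) \<and>
     filterlim T at_top even_at_top \<and>
     (\<rho> \<longlongrightarrow> 0) even_at_top \<and>
     (\<lambda>n. inverse (\<rho> n)) \<in> o[even_at_top](\<lambda>n. (real n)\<^sup>2)"

subsection \<open>Polynomials in the entries\<close>

text \<open>A monomial is a finitely supported exponent vector; a polynomial is a finitely supported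
  family of coefficients indexed by monomials.\<close>

type_synonym monomial = "entry \<Rightarrow>\<^sub>0 nat"
type_synonym tensor_poly = "monomial \<Rightarrow>\<^sub>0 real"

definition poly_vars :: "tensor_poly \<Rightarrow> entry set" where
  "poly_vars \<psi> = (\<Union>m\<in>Poly_Mapping.keys \<psi>. Poly_Mapping.keys m)"

definition monomial_degree :: "monomial \<Rightarrow> nat" where
  "monomial_degree m = (\<Sum>e\<in>Poly_Mapping.keys m. Poly_Mapping.lookup m e)"

definition total_degree :: "tensor_poly \<Rightarrow> nat" where
  "total_degree \<psi> = Max (insert 0 (monomial_degree ` Poly_Mapping.keys \<psi>))"

definition eval_poly :: "tensor_poly \<Rightarrow> tensor \<Rightarrow> real" where
  "eval_poly \<psi> A = (\<Sum>m\<in>Poly_Mapping.keys \<psi>. Poly_Mapping.lookup \<psi> m *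
     (\<Prod>e\<in>Poly_Mapping.keys m. of_bool (A e) ^ Poly_Mapping.lookup m e))"

subsection \<open>Polynomial-time tests\<close>

text \<open>Deterministic Turing machines with one two-way infinite tape. States and tape symbols are
  initial segments of the naturals; symbol 0 is the blank, and the symbols 1 and 2 are the input
  bits 0 and 1. The accepting state means output 1, the rejecting state output 0.\<close>

datatype move = Move_Left | Stay | Move_Right

record machine =
  num_states :: nat
  num_symbols :: nat
  start_state :: nat
  accept_state :: nat
  reject_state :: nat
  transition :: "nat \<Rightarrow> nat \<Rightarrow> nat \<times> nat \<times> move"

definition wf_machine :: "machine \<Rightarrow> bool" where
  "wf_machine M \<longleftrightarrow>
     3 \<le> num_symbols M \<and>
     start_state M < num_states M \<and>
     accept_state M < num_states M \<and>
     reject_state M < num_states M \<and>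
     accept_state M \<noteq> reject_state M \<and>
     (\<forall>q < num_states M. \<forall>s < num_symbols M. \<forall>q' s' d.
        transition M q s = (q', s', d) \<longrightarrow> q' < num_states M \<and> s' < num_symbols M)"

text \<open>State, tape contents, head position.\<close>

type_synonym config = "nat \<times> (int \<Rightarrow> nat) \<times> int"

fun head_shift :: "move \<Rightarrow> int" where
  "head_shift Move_Left = -1"
| "head_shift Stay = 0"
| "head_shift Move_Right = 1"

text \<open>Accepting and rejecting configurations are fixed points, so being in a halting state after
  exactly \<open>k\<close> steps means having halted within \<open>k\<close> steps.\<close>

definition step :: "machine \<Rightarrow> config \<Rightarrow> config" where
  "step M = (\<lambda>(q, tape, h).
     if q = accept_state M \<or> q = reject_state M then (q, tape, h)
     else (case transition M q (tape h) of
       (q', s', d) \<Rightarrow> (q', tape(h := s'), h + head_shift d)))"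

definition initial_config :: "machine \<Rightarrow> bool list \<Rightarrow> config" where
  "initial_config M w =
     (start_state M,
      (\<lambda>i. if 0 \<le> i \<and> i < int (length w) then (if w ! nat i then 2 else 1) else 0),
      0)"

definition outputs_within :: "machine \<Rightarrow> bool list \<Rightarrow> nat \<Rightarrow> bool \<Rightarrow> bool" where
  "outputs_within M w k b \<longleftrightarrow>
     fst ((step M ^^ k) (initial_config M w)) = (if b then accept_state M else reject_state M)"

text \<open>The input word is \<open>n\<close> in unary, a separating 0, and then the entries layer by layer, so
  that \<open>T\<close> can be recovered from the length of the word. With \<open>T\<close> not written in front, running
  times polynomial in \<open>n\<close> alone remain meaningful even if \<open>T\<close> is not polynomially bounded in
  \<open>n\<close>.\<close>

definition encode :: "nat \<Rightarrow> nat \<Rightarrow> tensor \<Rightarrow> bool list" where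
  "encode n T A = replicate n True @ [False] @
     [A (i, j, t). t \<leftarrow> [1..<Suc T], i \<leftarrow> [1..<Suc n], j \<leftarrow> [Suc i..<Suc n]]"

text \<open>One machine computes the whole sequence of tests, in time polynomial in \<open>n\<close>.\<close>

definition poly_time_test :: "(nat \<Rightarrow> nat) \<Rightarrow> (nat \<Rightarrow> tensor \<Rightarrow> bool) \<Rightarrow> bool" where
  "poly_time_test T \<psi> \<longleftrightarrow>
     (\<exists>M (p :: nat poly). wf_machine M \<and>
        (\<forall>n A. even n \<and> 0 < n \<longrightarrow> outputs_within M (encode n (T n) A) (poly p n) (\<psi> n A)))"

subsection \<open>Distinguishability and the low-degree conjecture\<close>

definition distinguishes ::
    "(nat \<Rightarrow> nat) \<Rightarrow> (nat \<Rightarrow> real) \<Rightarrow> (nat \<Rightarrow> tensor \<Rightarrow> bool) \<Rightarrow> bool" where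
  "distinguishes T \<rho> \<psi> \<longleftrightarrow>
     ((\<lambda>n. measure_pmf.prob (P1 n (T n) (\<rho> n)) {A. \<not> \<psi> n A} +
           measure_pmf.prob (P0 n (T n) (\<rho> n)) {A. \<psi> n A}) \<longlongrightarrow> 0) even_at_top"

definition poly_time_distinguishable :: "(nat \<Rightarrow> nat) \<Rightarrow> (nat \<Rightarrow> real) \<Rightarrow> bool" where
  "poly_time_distinguishable T \<rho> \<longleftrightarrow> (\<exists>\<psi>. distinguishes T \<rho> \<psi> \<and> poly_time_test T \<psi>)"

definition low_degree_bounded :: "(nat \<Rightarrow> nat) \<Rightarrow> (nat \<Rightarrow> real) \<Rightarrow> bool" where
  "low_degree_bounded T \<rho> \<longleftrightarrow>
     (\<exists>C. \<forall>\<^sub>F n in even_at_top. \<forall>\<psi>.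
        poly_vars \<psi> \<subseteq> entries n (T n) \<and>
        real (total_degree \<psi>) \<le> ln (real n) powr 1.01 \<and>
        measure_pmf.expectation (P0 n (T n) (\<rho> n)) (\<lambda>A. (eval_poly \<psi> A)\<^sup>2) = 1 \<and>
        measure_pmf.expectation (P0 n (T n) (\<rho> n)) (eval_poly \<psi>) = 0 \<longrightarrow>
        \<bar>measure_pmf.expectation (P1 n (T n) (\<rho> n)) (eval_poly \<psi>)\<bar> \<le> C)"

definition low_degree_conjecture :: bool where
  "low_degree_conjecture \<longleftrightarrow>
     (\<forall>T \<rho>. admissible T \<rho> \<longrightarrow> low_degree_bounded T \<rho> \<longrightarrow> \<not> poly_time_distinguishable T \<rho>)"

end

theory Submission
  imports
    Defs
    "HOL-Probability.Hoeffding"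
    "HOL-Combinatorics.Transposition"
    "HOL-Real_Asymp.Real_Asymp"
begin

text \<open>Expanding a polynomial of degree at most \<open>D\<close> in the orthonormal characters of the null law
  and applying Cauchy-Schwarz, it suffices to bound the sum over entry sets \<open>S\<close>, \<open>card S \<le> D\<close>, of
  the squared planted expectations of the characters. With two independent replicas
  \<open>(\<sigma>, \<tau>)\<close>, \<open>(\<sigma>', \<tau>')\<close> of the labels, the part with \<open>card S = d\<close> is at most
  \<open>(\<rho> / (4 (1 - \<rho>))) ^ d / d!\<close> times the \<open>d\<close>-th moment of \<open>(X\<^sup>2 - n) / 2 * Y\<close>, where \<open>X\<close> and \<open>Y\<close> are
  the overlaps of the vertex and layer labels. Both overlaps are sub-Gaussian, with variance
  proxies of order \<open>n\<close> and \<open>T\<close>, so the part is of order \<open>(C n \<rho> sqrt (d T)) ^ d\<close>. As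
  \<open>sqrt D = (log n) powr 0.505\<close>, the hypothesis makes these terms decay geometrically.\<close>

section \<open>Elementary exponential inequalities\<close>

text \<open>A single term of the exponential series is at most the whole series. It serves twice: to
  pass from exponential moments to power moments, and to bound
  \<open>d ^ d / fact d\<close>.\<close>

lemma power_le_fact_mult_exp:
  fixes x :: real
  assumes "0 \<le> x"
  shows "x ^ k \<le> fact k * exp x"
proof -
  have "(\<Sum>n\<in>{k}. x ^ n /\<^sub>R fact n) \<le> suminf (\<lambda>n. x ^ n /\<^sub>R fact n)"
    using assms by (intro sum_le_suminf summable_exp_generic) auto
  then show ?thesis
    by (simp add: exp_def field_simps)
qed

text \<open>This is Hoeffding's lemma for a fair sign. The auxiliary inequality behind it, with
  weight \<open>1/2\<close> and argument \<open>2 * u\<close>, turns into the claim after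
  exponentiation and multiplication by \<open>exp (- u)\<close>. It is stated for nonnegative
  arguments, hence \<open>u = \<bar>t\<bar>\<close>; \<open>cosh\<close> is even.\<close>

lemma cosh_le_exp_half_square:
  fixes t :: real
  shows "cosh t \<le> exp (t\<^sup>2 / 2)"
proof -
  define u where "u = \<bar>t\<bar>"
  have pos: "0 < 1 + (exp (2 * u) - 1) / 2"
    using add_pos_pos[OF zero_less_one exp_gt_zero[of "2 * u"]] by (simp add: field_simps)
  have "- (2 * u) * (1/2) + ln (1 + 1/2 * (exp (2 * u) - 1)) \<le> (2 * u)\<^sup>2 / 8"
    by (rule Hoeffdings_lemma_aux) (auto simp: u_def)
  then have "ln (1 + (exp (2 * u) - 1) / 2) \<le> u + u\<^sup>2 / 2"
    by (simp add: power2_eq_square)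
  then have "1 + (exp (2 * u) - 1) / 2 \<le> exp (u + u\<^sup>2 / 2)"
    using pos by (metis exp_le_cancel_iff exp_ln)
  then have "(1 + exp (2 * u)) / 2 * exp (- u) \<le> exp (u + u\<^sup>2 / 2) * exp (- u)"
    by (intro mult_right_mono) (auto simp: field_simps)
  also have "exp (u + u\<^sup>2 / 2) * exp (- u) = exp (u\<^sup>2 / 2)"
    by (simp flip: exp_add)
  also have "(1 + exp (2 * u)) / 2 * exp (- u) = cosh u"
    by (simp add: cosh_field_def field_simps flip: exp_add)
  finally show ?thesis
    by (simp add: u_def)
qed

section \<open>Balanced labellings and their symmetry\<close>

text \<open>In signs, the bias of an entry becomes a product of three factors. Every nonzero
  argument goes to -1, so that spins square to 1 even at indices outside the range of a
  labelling.\<close>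

definition spin :: "nat \<Rightarrow> real" where
  "spin a = (if a = 0 then 1 else - 1)"

lemma finite_balanced [simp]: "finite (balanced m)"
proof -
  have "finite ({1..m} \<rightarrow>\<^sub>E {0, 1::nat})"
    by (intro finite_PiE) auto
  then show ?thesis
    by (rule rev_finite_subset) (auto simp: balanced_def)
qed

lemma balanced_label: "\<sigma> \<in> balanced m \<Longrightarrow> i \<in> {1..m} \<Longrightarrow> \<sigma> i = 0 \<or> \<sigma> i = 1"
  by (auto simp: balanced_def PiE_def Pi_def)

text \<open>Labelling the first \<open>m div 2\<close> indices by 1 gives a witness. Nonemptiness
  makes \<open>pmf_of_set (balanced m)\<close> the uniform law.\<close>

lemma balanced_nonempty [simp]: "balanced m \<noteq> {}"
proof -
  define \<sigma> :: "nat \<Rightarrow> nat" where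
    "\<sigma> = restrict (\<lambda>i. if i \<in> {1..m div 2} then 1 else 0) {1..m}"
  have "(\<Sum>i\<in>{1..m}. \<sigma> i) = (\<Sum>i\<in>{1..m}. if i \<in> {1..m div 2} then 1 else 0)"
    by (intro sum.cong) (auto simp: \<sigma>_def)
  also have "\<dots> = (\<Sum>i\<in>{1..m} \<inter> {1..m div 2}. 1)"
    by (subst sum.inter_restrict) auto
  also have "{1..m} \<inter> {1..m div 2} = {1..m div 2}"
    by auto
  finally have "\<sigma> \<in> balanced m"
    by (auto simp: balanced_def \<sigma>_def PiE_def extensional_def)
  then show ?thesis by blast
qed

lemma card_balanced_pos [simp]: "0 < card (balanced m)"
  by (simp add: card_gt_0_iff)

text \<open>A transposition inside \<open>{1..m}\<close> permutes the summands and fixes all indices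
  outside, so both the label sum and extensionality survive. This is the only symmetry of the
  uniform law that enters.\<close>

lemma balanced_transpose:
  assumes "\<sigma> \<in> balanced m" "a \<in> {1..m}" "b \<in> {1..m}"
  shows "\<sigma> \<circ> Transposition.transpose a b \<in> balanced m"
proof -
  have bij: "bij_betw (Transposition.transpose a b) {1..m} {1..m}"
    using assms(2,3) by (simp add: bij_betw_def)
  have "(\<Sum>i\<in>{1..m}. \<sigma> (Transposition.transpose a b i)) = (\<Sum>i\<in>{1..m}. \<sigma> i)"
    by (rule sum.reindex_bij_betw[OF bij])
  moreover have "\<sigma> \<circ> Transposition.transpose a b \<in> {1..m} \<rightarrow>\<^sub>E {0, 1}"
  proof (rule PiE_I)
    fix i assume "i \<in> {1..m}"
    then have "Transposition.transpose a b i \<in> {1..m}"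
      using bij by (rule bij_betwE[rule_format, rotated])
    then show "(\<sigma> \<circ> Transposition.transpose a b) i \<in> {0, 1}"
      using assms(1) balanced_label by fastforce
  next
    fix i assume "i \<notin> {1..m}"
    moreover from this have "Transposition.transpose a b i = i"
      using assms(2,3) by (metis transpose_apply_other)
    ultimately show "(\<sigma> \<circ> Transposition.transpose a b) i = undefined"
      using assms(1) by (simp add: balanced_def PiE_def extensional_def)
  qed
  ultimately show ?thesis
    using assms(1) by (simp add: balanced_def)
qed

text \<open>The label sum counts the nonzero labels. For even \<open>m\<close> the two classes are
  equally large, so they can be matched by a bijection.\<close>

lemma card_balanced_fibres:
  assumes "\<sigma> \<in> balanced m" "even m"
  shows "card {i \<in> {1..m}. \<sigma> i = 0} = m div 2" "card {i \<in> {1..m}. \<sigma> i \<noteq> 0} = m div 2"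
proof -
  have "m div 2 = (\<Sum>i\<in>{1..m}. \<sigma> i)"
    using assms(1) by (simp add: balanced_def)
  also have "\<dots> = (\<Sum>i\<in>{1..m}. if \<sigma> i \<noteq> 0 then 1 else 0)"
  proof (intro sum.cong refl)
    fix i assume "i \<in> {1..m}"
    from balanced_label[OF assms(1) this] show "\<sigma> i = (if \<sigma> i \<noteq> 0 then 1 else 0)"
      by auto
  qed
  also have "\<dots> = card {i \<in> {1..m}. \<sigma> i \<noteq> 0}"
    by (subst sum.inter_filter[symmetric]) auto
  finally show *: "card {i \<in> {1..m}. \<sigma> i \<noteq> 0} = m div 2" by simp
  have "card {1..m} = card ({i \<in> {1..m}. \<sigma> i = 0} \<union> {i \<in> {1..m}. \<sigma> i \<noteq> 0})"
    by (intro arg_cong[where f = card]) auto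
  also have "\<dots> = card {i \<in> {1..m}. \<sigma> i = 0} + card {i \<in> {1..m}. \<sigma> i \<noteq> 0}"
    by (intro card_Un_disjoint) auto
  finally show "card {i \<in> {1..m}. \<sigma> i = 0} = m div 2"
    using * assms(2) by auto
qed

text \<open>The uniform law on balanced labellings is invariant under exchanging the labels of \<open>i\<close> and
  \<open>f i\<close>; averaging over this exchange replaces one factor of the exponential by a hyperbolic cosine.\<close>

lemma sum_exp_matched_differences_le:
  fixes s :: real
  assumes "finite Q" "Q \<subseteq> {1..m}" "inj_on f Q" "f ` Q \<subseteq> {1..m}" "f ` Q \<inter> Q = {}"
  shows "(\<Sum>\<sigma>\<in>balanced m. exp (\<Sum>i\<in>Q. s * (spin (\<sigma> i) - spin (\<sigma> (f i)))))
           \<le> card (balanced m) * exp (2 * s\<^sup>2) ^ card Q"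
  using assms
proof (induction Q rule: finite_induct)
  case empty
  then show ?case by simp
next
  case (insert a Q)
  define \<delta> where "\<delta> i \<sigma> = spin (\<sigma> i) - spin (\<sigma> (f i))" for i and \<sigma> :: "nat \<Rightarrow> nat"
  define R where "R \<sigma> = exp (\<Sum>i\<in>Q. s * \<delta> i \<sigma>)" for \<sigma>
  let ?\<pi> = "\<lambda>\<sigma>::nat\<Rightarrow>nat. \<sigma> \<circ> Transposition.transpose a (f a)"
  let ?B = "balanced m"
  have ab: "a \<in> {1..m}" "f a \<in> {1..m}" "f a \<noteq> a"
    using insert.prems by auto
  \<comment> \<open>Injectivity of \<open>f\<close> and disjointness of its image from the index set
    keep \<open>a\<close> and \<open>f a\<close> apart from all remaining pairs. The exchange thus
    leaves \<open>R\<close> alone and only flips the sign of \<open>\<delta> a\<close>.\<close>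
  have other: "Transposition.transpose a (f a) i = i" "Transposition.transpose a (f a) (f i) = f i" if "i \<in> Q" for i
  proof -
    have "i \<noteq> f a" "i \<noteq> a" "f i \<noteq> a" "f i \<noteq> f a"
      using that insert.prems(2,4) insert.hyps(2) by (blast, blast, blast, metis inj_on_eq_iff insertCI)
    then show "Transposition.transpose a (f a) i = i" "Transposition.transpose a (f a) (f i) = f i"
      by (simp_all add: transpose_apply_other)
  qed
  have R: "R (?\<pi> \<sigma>) = R \<sigma>" for \<sigma>
    unfolding R_def \<delta>_def by (intro arg_cong[where f = exp] sum.cong) (auto simp: other)
  have flip: "\<delta> a (?\<pi> \<sigma>) = - \<delta> a \<sigma>" for \<sigma>
    by (simp add: \<delta>_def)
  have "(\<Sum>\<sigma>\<in>?B. R \<sigma> * exp (s * \<delta> a \<sigma>)) = (\<Sum>\<sigma>\<in>?B. R \<sigma> * exp (- (s * \<delta> a \<sigma>)))"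
    by (rule sum.reindex_bij_witness[of _ ?\<pi> ?\<pi>])
      (use ab in \<open>auto simp: balanced_transpose R flip comp_assoc\<close>)
  then have "(\<Sum>\<sigma>\<in>?B. R \<sigma> * exp (s * \<delta> a \<sigma>)) = (\<Sum>\<sigma>\<in>?B. R \<sigma> * cosh (s * \<delta> a \<sigma>))"
    by (simp add: cosh_field_def distrib_left sum.distrib flip: sum_divide_distrib)
  also have "\<dots> \<le> (\<Sum>\<sigma>\<in>?B. R \<sigma> * exp (2 * s\<^sup>2))"
  proof (intro sum_mono mult_left_mono)
    fix \<sigma>
    \<comment> \<open>A difference of two spins is -2, 0 or 2; the constant
      \<open>2 * s\<^sup>2\<close> is half of \<open>4 * s\<^sup>2\<close>.\<close>
    have "(\<delta> a \<sigma>)\<^sup>2 \<le> 4"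
      by (auto simp: \<delta>_def spin_def)
    then have "s\<^sup>2 * (\<delta> a \<sigma>)\<^sup>2 \<le> s\<^sup>2 * 4"
      by (intro mult_left_mono) auto
    then have "exp ((s * \<delta> a \<sigma>)\<^sup>2 / 2) \<le> exp (2 * s\<^sup>2)"
      by (simp add: power_mult_distrib)
    then show "cosh (s * \<delta> a \<sigma>) \<le> exp (2 * s\<^sup>2)"
      using cosh_le_exp_half_square order_trans by blast
  qed (simp add: R_def)
  also have "\<dots> \<le> card ?B * exp (2 * s\<^sup>2) ^ card Q * exp (2 * s\<^sup>2)"
    using insert.IH insert.prems
    by (auto simp: R_def \<delta>_def simp flip: sum_distrib_right intro!: mult_right_mono)
  finally show ?case
    using insert.hyps by (simp add: R_def \<delta>_def exp_add mult_ac)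
qed

section \<open>Exponential and power moments of the overlap\<close>

definition overlap :: "nat \<Rightarrow> (nat \<Rightarrow> nat) \<Rightarrow> (nat \<Rightarrow> nat) \<Rightarrow> real" where
  "overlap m \<sigma> \<sigma>' = (\<Sum>i\<in>{1..m}. spin (\<sigma> i) * spin (\<sigma>' i))"

text \<open>Match the zeros \<open>Q\<close> of the fixed labelling with its ones \<open>N\<close>.
  The overlap is then a sum of \<open>m div 2\<close> matched differences of spins, each of which
  costs a factor \<open>exp (2 * s\<^sup>2)\<close>.\<close>

lemma sum_exp_overlap_le:
  assumes "\<sigma> \<in> balanced m" "even m"
  shows "(\<Sum>\<sigma>'\<in>balanced m. exp (s * overlap m \<sigma> \<sigma>')) \<le> card (balanced m) * exp (s\<^sup>2 * m)"
proof -
  define Q where "Q = {i \<in> {1..m}. \<sigma> i = 0}"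
  define N where "N = {i \<in> {1..m}. \<sigma> i \<noteq> 0}"
  have card: "card Q = m div 2" "card N = m div 2"
    unfolding Q_def N_def by (rule card_balanced_fibres[OF assms])+
  have fin: "finite Q" "finite N"
    by (auto simp: Q_def N_def)
  obtain f where f: "bij_betw f Q N"
    using finite_same_card_bij[OF fin] card by auto
  have "overlap m \<sigma> \<sigma>' = (\<Sum>i\<in>Q. spin (\<sigma>' i) - spin (\<sigma>' (f i)))" for \<sigma>'
  proof -
    have "overlap m \<sigma> \<sigma>' = (\<Sum>i\<in>Q \<union> N. spin (\<sigma> i) * spin (\<sigma>' i))"
      unfolding overlap_def by (intro sum.cong) (auto simp: Q_def N_def)
    also have "\<dots> = (\<Sum>i\<in>Q. spin (\<sigma> i) * spin (\<sigma>' i)) + (\<Sum>i\<in>N. spin (\<sigma> i) * spin (\<sigma>' i))"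
      using fin by (intro sum.union_disjoint) (auto simp: Q_def N_def)
    also have "\<dots> = (\<Sum>i\<in>Q. spin (\<sigma>' i)) - (\<Sum>i\<in>N. spin (\<sigma>' i))"
      by (simp add: Q_def N_def spin_def sum_negf)
    also have "(\<Sum>i\<in>N. spin (\<sigma>' i)) = (\<Sum>i\<in>Q. spin (\<sigma>' (f i)))"
      by (rule sum.reindex_bij_betw[OF f, symmetric])
    finally show ?thesis by (simp add: sum_subtractf)
  qed
  then have "(\<Sum>\<sigma>'\<in>balanced m. exp (s * overlap m \<sigma> \<sigma>')) =
      (\<Sum>\<sigma>'\<in>balanced m. exp (\<Sum>i\<in>Q. s * (spin (\<sigma>' i) - spin (\<sigma>' (f i)))))"
    by (simp add: sum_distrib_left)
  also have "\<dots> \<le> card (balanced m) * exp (2 * s\<^sup>2) ^ card Q"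
    using f by (intro sum_exp_matched_differences_le) (auto simp: bij_betw_def Q_def N_def)
  also have "exp (2 * s\<^sup>2) ^ card Q = exp (s\<^sup>2 * m)"
    using assms(2) by (auto simp: card mult_ac simp flip: exp_of_nat_mult elim!: evenE)
  finally show ?thesis .
qed

text \<open>The sub-Gaussian bound at \<open>s\<close> and \<open>- s\<close> controls
  \<open>exp \<bar>s * X\<bar>\<close> for the overlap \<open>X\<close>, hence its
  \<open>k\<close>-th power moment; the two signs account for the factor 2.\<close>

lemma sum_overlap_moment_le:
  assumes "even m" "0 < m" "0 < k"
  shows "(\<Sum>\<sigma>\<in>balanced m. \<Sum>\<sigma>'\<in>balanced m. \<bar>overlap m \<sigma> \<sigma>'\<bar> ^ k)
           \<le> (card (balanced m))\<^sup>2 * (2 * (exp 1 * sqrt (k * m)) ^ k)"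
proof -
  \<comment> \<open>With this scale \<open>exp (s\<^sup>2 * m)\<close> is just
    \<open>exp 1 ^ k\<close>, while \<open>k ^ k / s ^ k\<close> becomes
    \<open>sqrt (k * m) ^ k\<close>.\<close>
  define s where "s = sqrt (k / m)"
  have s: "0 < s" "s\<^sup>2 * m = k" "k / s = sqrt (k * m)"
    using assms(2,3) by (auto simp: s_def real_sqrt_divide real_sqrt_mult field_simps)
  have "(\<Sum>\<sigma>'\<in>balanced m. \<bar>overlap m \<sigma> \<sigma>'\<bar> ^ k) \<le>
      card (balanced m) * (2 * (exp 1 * sqrt (k * m)) ^ k)" if "\<sigma> \<in> balanced m" for \<sigma>
  proof -
    have "s ^ k * (\<Sum>\<sigma>'\<in>balanced m. \<bar>overlap m \<sigma> \<sigma>'\<bar> ^ k)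
        = (\<Sum>\<sigma>'\<in>balanced m. \<bar>s * overlap m \<sigma> \<sigma>'\<bar> ^ k)"
      using s(1) by (simp add: sum_distrib_left abs_mult power_mult_distrib)
    also have "\<dots> \<le> (\<Sum>\<sigma>'\<in>balanced m. fact k *
        (exp (s * overlap m \<sigma> \<sigma>') + exp (- s * overlap m \<sigma> \<sigma>')))"
    proof (intro sum_mono)
      fix \<sigma>'
      let ?x = "s * overlap m \<sigma> \<sigma>'"
      have "\<bar>?x\<bar> ^ k \<le> fact k * exp \<bar>?x\<bar>"
        by (rule power_le_fact_mult_exp) simp
      also have "\<dots> \<le> fact k * (exp ?x + exp (- ?x))"
        by (intro mult_left_mono) (auto simp: abs_if)
      finally show "\<bar>?x\<bar> ^ k \<le> fact k * (exp ?x + exp (- s * overlap m \<sigma> \<sigma>'))" by simp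
    qed
    also have "\<dots> = fact k * ((\<Sum>\<sigma>'\<in>balanced m. exp (s * overlap m \<sigma> \<sigma>')) +
        (\<Sum>\<sigma>'\<in>balanced m. exp (- s * overlap m \<sigma> \<sigma>')))"
      by (simp add: sum.distrib flip: sum_distrib_left)
    also have "\<dots> \<le> fact k * (card (balanced m) * exp (s\<^sup>2 * m) + card (balanced m) * exp ((- s)\<^sup>2 * m))"
      by (intro mult_left_mono add_mono sum_exp_overlap_le that assms(1)) auto
    also have "\<dots> = fact k * (card (balanced m) * (2 * exp 1 ^ k))"
      using s(2) by (simp flip: exp_of_nat_mult)
    also have "\<dots> \<le> real k ^ k * (card (balanced m) * (2 * exp 1 ^ k))"
      by (intro mult_right_mono) (use fact_le_power[of k, where 'a = real] in auto)
    finally have "(\<Sum>\<sigma>'\<in>balanced m. \<bar>overlap m \<sigma> \<sigma>'\<bar> ^ k) \<le>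
        real k ^ k * (card (balanced m) * (2 * exp 1 ^ k)) / s ^ k"
      using s(1) by (simp add: field_simps)
    also have "\<dots> = card (balanced m) * (2 * (exp 1 * (k / s)) ^ k)"
      by (simp add: power_mult_distrib power_divide)
    finally show ?thesis
      using s(3) by simp
  qed
  then have "(\<Sum>\<sigma>\<in>balanced m. \<Sum>\<sigma>'\<in>balanced m. \<bar>overlap m \<sigma> \<sigma>'\<bar> ^ k) \<le>
      (\<Sum>\<sigma>\<in>balanced m. card (balanced m) * (2 * (exp 1 * sqrt (k * m)) ^ k))"
    by (rule sum_mono)
  then show ?thesis
    by (simp add: power2_eq_square)
qed

section \<open>Averages over replicas\<close>

text \<open>Double counting of the pairs of a set \<open>S\<close> of size \<open>Suc d\<close> and
  an element \<open>e\<close> of it; such a pair corresponds to \<open>e\<close> together with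
  \<open>S - {e}\<close>.\<close>

lemma card_Suc_subsets_sum:
  fixes F :: "'e set \<Rightarrow> real"
  assumes "finite E"
  shows "Suc d * (\<Sum>S | S \<subseteq> E \<and> card S = Suc d. F S) =
           (\<Sum>e\<in>E. \<Sum>S | S \<subseteq> E \<and> card S = d \<and> e \<notin> S. F (insert e S))"
proof -
  have fin: "finite {S. S \<subseteq> E \<and> P S}" for P
    using assms by auto
  have "Suc d * (\<Sum>S | S \<subseteq> E \<and> card S = Suc d. F S) =
      (\<Sum>S | S \<subseteq> E \<and> card S = Suc d. \<Sum>e\<in>S. F S)"
    unfolding sum_distrib_left by (intro sum.cong) auto
  also have "\<dots> = (\<Sum>(S, e)\<in>(SIGMA S:{S. S \<subseteq> E \<and> card S = Suc d}. S). F S)"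
    using assms by (intro sum.Sigma fin) (auto intro: finite_subset)
  also have "\<dots> = (\<Sum>(e, S)\<in>(SIGMA e:E. {S. S \<subseteq> E \<and> card S = d \<and> e \<notin> S}). F (insert e S))"
    by (rule sum.reindex_bij_witness[of _ "\<lambda>(e, S). (insert e S, e)" "\<lambda>(S, e). (e, S - {e})"])
      (use assms in \<open>auto simp: insert_absorb card_Diff_singleton finite_subset[OF _ assms]\<close>)
  also have "\<dots> = (\<Sum>e\<in>E. \<Sum>S | S \<subseteq> E \<and> card S = d \<and> e \<notin> S. F (insert e S))"
    using assms by (intro sum.Sigma[symmetric] fin ballI)
  finally show ?thesis .
qed

text \<open>Squaring duplicates the average over \<open>\<Omega>\<close> into an average over independent replicas. As every
  squared term is nonnegative, sets of \<open>d\<close> elements may be enlarged to sequences of length \<open>d\<close>.\<close>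

lemma replica_bound:
  fixes w :: "'e \<Rightarrow> 'o \<Rightarrow> real"
  assumes "finite E" "finite \<Omega>"
  shows "fact d * (\<Sum>S | S \<subseteq> E \<and> card S = d. (\<Sum>\<omega>\<in>\<Omega>. h \<omega> * (\<Prod>e\<in>S. w e \<omega>))\<^sup>2)
           \<le> (\<Sum>\<omega>\<in>\<Omega>. \<Sum>\<omega>'\<in>\<Omega>. h \<omega> * h \<omega>' * (\<Sum>e\<in>E. w e \<omega> * w e \<omega>') ^ d)"
\<comment> \<open>The weight \<open>h\<close> has to vary: the factor \<open>w e\<close> of the
  adjoined element is absorbed into it, and summing over \<open>e\<close> afterwards produces one
  more power of the kernel.\<close>
proof (induction d arbitrary: h)
  case 0
  have "{S. S \<subseteq> E \<and> card S = 0} = {{}}"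
    using assms(1) by (auto simp: card_eq_0_iff dest: finite_subset)
  then show ?case
    by (simp add: power2_eq_square sum_product)
next
  case (Suc d)
  define F where "F h S = (\<Sum>\<omega>\<in>\<Omega>. h \<omega> * (\<Prod>e\<in>S. w e \<omega>))\<^sup>2" for h S
  have "fact (Suc d) * (\<Sum>S | S \<subseteq> E \<and> card S = Suc d. F h S) =
      fact d * (\<Sum>e\<in>E. \<Sum>S | S \<subseteq> E \<and> card S = d \<and> e \<notin> S. F h (insert e S))"
    unfolding card_Suc_subsets_sum[OF assms(1), symmetric] by (simp only: fact_Suc of_nat_mult mult_ac)
  also have "\<dots> = fact d * (\<Sum>e\<in>E. \<Sum>S | S \<subseteq> E \<and> card S = d \<and> e \<notin> S. F (\<lambda>\<omega>. h \<omega> * w e \<omega>) S)"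
  proof -
    have "F h (insert e S) = F (\<lambda>\<omega>. h \<omega> * w e \<omega>) S" if "S \<subseteq> E" "e \<notin> S" for e S
      using that finite_subset[OF that(1) assms(1)] by (simp add: F_def mult.assoc)
    then show ?thesis by simp
  qed
  also have "\<dots> \<le> fact d * (\<Sum>e\<in>E. \<Sum>S | S \<subseteq> E \<and> card S = d. F (\<lambda>\<omega>. h \<omega> * w e \<omega>) S)"
    using assms(1) by (intro mult_left_mono sum_mono sum_mono2) (auto simp: F_def)
  also have "\<dots> = (\<Sum>e\<in>E. fact d * (\<Sum>S | S \<subseteq> E \<and> card S = d. F (\<lambda>\<omega>. h \<omega> * w e \<omega>) S))"
    by (simp add: sum_distrib_left)
  also have "\<dots> \<le> (\<Sum>e\<in>E. \<Sum>\<omega>\<in>\<Omega>. \<Sum>\<omega>'\<in>\<Omega>. (h \<omega> * w e \<omega>) * (h \<omega>' * w e \<omega>') *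
      (\<Sum>e\<in>E. w e \<omega> * w e \<omega>') ^ d)"
    unfolding F_def by (intro sum_mono Suc.IH)
  also have "\<dots> = (\<Sum>\<omega>\<in>\<Omega>. \<Sum>\<omega>'\<in>\<Omega>. \<Sum>e\<in>E. (h \<omega> * w e \<omega>) * (h \<omega>' * w e \<omega>') *
      (\<Sum>e\<in>E. w e \<omega> * w e \<omega>') ^ d)"
    by (subst sum.swap) (intro sum.cong refl sum.swap)
  also have "\<dots> = (\<Sum>\<omega>\<in>\<Omega>. \<Sum>\<omega>'\<in>\<Omega>. h \<omega> * h \<omega>' * (\<Sum>e\<in>E. w e \<omega> * w e \<omega>') ^ Suc d)"
    by (simp add: sum_distrib_left sum_distrib_right mult_ac)
  finally show ?case
    by (simp add: F_def)
qed

section \<open>Product measures and expansion in characters\<close>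

lemma finite_entries [simp]: "finite (entries n T)"
  by (rule finite_subset[of _ "{1..n} \<times> {1..n} \<times> {1..T}"]) (auto simp: entries_def)

lemma finite_set_Pi_pmf:
  fixes p :: "'e \<Rightarrow> 'b::finite pmf"
  assumes "finite E"
  shows "finite (set_pmf (Pi_pmf E dflt p))"
  using assms by (auto simp: set_Pi_pmf)

text \<open>The coordinates of \<open>Pi_pmf\<close> are independent, and finite support makes all
  functions integrable, so the factors may take either sign.\<close>

lemma expectation_prod_Pi_pmf_signed:
  fixes p :: "'e \<Rightarrow> 'b::finite pmf" and f :: "'e \<Rightarrow> 'b \<Rightarrow> real"
  assumes "finite E"
  shows "measure_pmf.expectation (Pi_pmf E dflt p) (\<lambda>A. \<Prod>e\<in>E. f e (A e)) =
           (\<Prod>e\<in>E. measure_pmf.expectation (p e) (f e))"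
proof -
  let ?M = "Pi_pmf E dflt p"
  have "prob_space.indep_vars ?M (\<lambda>_. borel) (\<lambda>e A. f e (A e)) E"
    by (rule prob_space.indep_vars_compose2[OF prob_space_measure_pmf indep_vars_Pi_pmf[OF assms]]) auto
  then have "measure_pmf.expectation ?M (\<lambda>A. \<Prod>e\<in>E. f e (A e)) =
      (\<Prod>e\<in>E. measure_pmf.expectation ?M (\<lambda>A. f e (A e)))"
    by (intro prob_space.indep_vars_lebesgue_integral[OF prob_space_measure_pmf] assms
        integrable_measure_pmf_finite finite_set_Pi_pmf)
  also have "\<dots> = (\<Prod>e\<in>E. measure_pmf.expectation (p e) (f e))"
  proof (intro prod.cong refl)
    fix e assume "e \<in> E"
    have "measure_pmf.expectation ?M (\<lambda>A. f e (A e)) =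
        measure_pmf.expectation (map_pmf (\<lambda>A. A e) ?M) (f e)"
      by simp
    also have "map_pmf (\<lambda>A. A e) ?M = p e"
      using \<open>e \<in> E\<close> by (simp add: Pi_pmf_component[OF assms])
    finally show "measure_pmf.expectation ?M (\<lambda>A. f e (A e)) = measure_pmf.expectation (p e) (f e)" .
  qed
  finally show ?thesis .
qed

text \<open>The standard deviation of a Bernoulli variable.\<close>

definition bernoulli_scale :: "real \<Rightarrow> real" where
  "bernoulli_scale \<rho> = sqrt (\<rho> * (1 - \<rho>))"

text \<open>The biased Fourier-Walsh character: a product of standardised entries.\<close>

definition character :: "real \<Rightarrow> 'e set \<Rightarrow> ('e \<Rightarrow> bool) \<Rightarrow> real" where
  "character \<rho> S A = (\<Prod>e\<in>S. (of_bool (A e) - \<rho>) / bernoulli_scale \<rho>)"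

lemma bernoulli_scale_pos: "0 < \<rho> \<Longrightarrow> \<rho> < 1 \<Longrightarrow> 0 < bernoulli_scale \<rho>"
  by (simp add: bernoulli_scale_def)

lemma bernoulli_scale_square: "0 < \<rho> \<Longrightarrow> \<rho> < 1 \<Longrightarrow> bernoulli_scale \<rho> * bernoulli_scale \<rho> = \<rho> * (1 - \<rho>)"
  by (simp add: bernoulli_scale_def)

text \<open>Filling up with factors 1 gives a product over all coordinates, the shape in which
  expectations under \<open>Pi_pmf\<close> factorise.\<close>

lemma character_restrict:
  assumes "finite E" "S \<subseteq> E"
  shows "character \<rho> S A =
           (\<Prod>e\<in>E. if e \<in> S then (of_bool (A e) - \<rho>) / bernoulli_scale \<rho> else 1)"
  unfolding character_def using assms
  by (simp add: prod.inter_restrict[symmetric] Int_absorb1)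

text \<open>The expectation factorises over coordinates. A coordinate in both sets gives the
  variance 1, one in neither gives 1, and one in exactly one set gives the mean 0.\<close>

lemma character_orthonormal:
  fixes S S' :: "'e set"
  assumes "0 < \<rho>" "\<rho> < 1" "finite E" "S \<subseteq> E" "S' \<subseteq> E"
  shows "measure_pmf.expectation (Pi_pmf E False (\<lambda>_. bernoulli_pmf \<rho>))
           (\<lambda>A. character \<rho> S A * character \<rho> S' A) = of_bool (S = S')"
proof -
  define g where "g b = (of_bool b - \<rho>) / bernoulli_scale \<rho>" for b
  define f where "f e b = (if e \<in> S then g b else 1) * (if e \<in> S' then g b else 1)" for e b
  have "(\<lambda>A. character \<rho> S A * character \<rho> S' A) = (\<lambda>A. \<Prod>e\<in>E. f e (A e))"
    unfolding character_restrict[OF assms(3,4)] character_restrict[OF assms(3,5)]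
      f_def g_def prod.distrib ..
  then have "measure_pmf.expectation (Pi_pmf E False (\<lambda>_. bernoulli_pmf \<rho>))
      (\<lambda>A. character \<rho> S A * character \<rho> S' A) =
      (\<Prod>e\<in>E. measure_pmf.expectation (bernoulli_pmf \<rho>) (f e))"
    using expectation_prod_Pi_pmf_signed[OF assms(3), of False "\<lambda>_. bernoulli_pmf \<rho>" f] by simp
  also have "\<dots> = (\<Prod>e\<in>E. of_bool (e \<in> S \<longleftrightarrow> e \<in> S'))"
  proof (intro prod.cong refl)
    fix e
    have "g True * g True * \<rho> + g False * g False * (1 - \<rho>) =
        ((1 - \<rho>)\<^sup>2 * \<rho> + \<rho>\<^sup>2 * (1 - \<rho>)) / (bernoulli_scale \<rho> * bernoulli_scale \<rho>)"
      by (simp add: g_def power2_eq_square add_divide_distrib)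
    also have "\<dots> = 1"
      using assms(1,2) by (simp add: bernoulli_scale_square field_simps power2_eq_square)
    finally have 2: "g True * g True * \<rho> + g False * g False * (1 - \<rho>) = 1" .
    have 1: "g True * \<rho> + g False * (1 - \<rho>) = 0"
      by (simp add: g_def algebra_simps)
    show "measure_pmf.expectation (bernoulli_pmf \<rho>) (f e) = of_bool (e \<in> S \<longleftrightarrow> e \<in> S')"
      using assms(1,2) 1 2 by (auto simp: f_def)
  qed
  also have "\<dots> = of_bool (S = S')"
  proof (cases "S = S'")
    case False
    then obtain e where "e \<in> E" "\<not> (e \<in> S \<longleftrightarrow> e \<in> S')"
      using assms(4,5) by blast
    then have "(\<Prod>e\<in>E. of_bool (e \<in> S \<longleftrightarrow> e \<in> S') :: real) = 0"
      using assms(3) by (intro prod_zero) auto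
    with False show ?thesis by simp
  qed simp
  finally show ?thesis .
qed

text \<open>Write each indicator as \<open>\<rho>\<close> plus \<open>bernoulli_scale \<rho>\<close>
  times its standardisation and multiply out.\<close>

lemma prod_of_bool_eq_sum_character:
  assumes "finite K" "0 < \<rho>" "\<rho> < 1"
  shows "(\<Prod>e\<in>K. of_bool (A e)) =
           (\<Sum>S\<in>Pow K. bernoulli_scale \<rho> ^ card S * \<rho> ^ card (K - S) * character \<rho> S A)"
proof -
  let ?q = "bernoulli_scale \<rho>"
  have "(\<Prod>e\<in>K. of_bool (A e)) = (\<Prod>e\<in>K. ?q * ((of_bool (A e) - \<rho>) / ?q) + \<rho>)"
    using bernoulli_scale_pos[OF assms(2,3)] by simp
  also have "\<dots> = (\<Sum>S\<in>Pow K. (\<Prod>e\<in>S. ?q * ((of_bool (A e) - \<rho>) / ?q)) * (\<Prod>e\<in>K - S. \<rho>))"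
    by (rule prod_add[OF assms(1)])
  also have "\<dots> = (\<Sum>S\<in>Pow K. ?q ^ card S * \<rho> ^ card (K - S) * character \<rho> S A)"
    by (simp only: prod.distrib prod_constant character_def mult_ac)
  finally show ?thesis .
qed

lemma card_keys_le_monomial_degree: "card (Poly_Mapping.keys m) \<le> monomial_degree m"
proof -
  have "(\<Sum>e\<in>Poly_Mapping.keys m. 1) \<le> monomial_degree m"
    unfolding monomial_degree_def by (intro sum_mono) (auto simp: in_keys_iff)
  then show ?thesis by simp
qed

text \<open>A monomial evaluates to the product of the indicators in its support, which has at most
  as many elements as the degree. So only characters of sets up to the total degree occur.\<close>

lemma eval_poly_eq_sum_character:
  assumes "0 < \<rho>" "\<rho> < 1" "finite E" "poly_vars \<psi> \<subseteq> E"
  obtains c where "eval_poly \<psi> =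
    (\<lambda>A. \<Sum>S | S \<subseteq> E \<and> card S \<le> total_degree \<psi>. c S * character \<rho> S A)"
proof
  let ?F = "{S. S \<subseteq> E \<and> card S \<le> total_degree \<psi>}"
  \<comment> \<open>The coefficient of the character of \<open>S\<close> in the monomial
    \<open>m\<close>; the value 0 off the subsets of the support lets all monomials share one index
    set.\<close>
  define b where "b m S = (if S \<subseteq> Poly_Mapping.keys m
    then bernoulli_scale \<rho> ^ card S * \<rho> ^ card (Poly_Mapping.keys m - S) else 0)"
    for m :: monomial and S
  define c where "c S = (\<Sum>m\<in>Poly_Mapping.keys \<psi>. Poly_Mapping.lookup \<psi> m * b m S)" for S
  have finF: "finite ?F" using assms(3) by auto
  have mono: "(\<Prod>e\<in>Poly_Mapping.keys m. of_bool (A e) ^ Poly_Mapping.lookup m e) =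
      (\<Sum>S\<in>?F. b m S * character \<rho> S A)" if m: "m \<in> Poly_Mapping.keys \<psi>" for m A
  proof -
    \<comment> \<open>Positive powers of 0 and 1 are idempotent, and exponents on the support are
      positive.\<close>
    have "(\<Prod>e\<in>Poly_Mapping.keys m. of_bool (A e) ^ Poly_Mapping.lookup m e) =
        (\<Prod>e\<in>Poly_Mapping.keys m. of_bool (A e) :: real)"
      by (intro prod.cong refl) (simp add: in_keys_iff zero_power)
    also have "\<dots> = (\<Sum>S\<in>Pow (Poly_Mapping.keys m). b m S * character \<rho> S A)"
      by (simp add: prod_of_bool_eq_sum_character[OF _ assms(1,2)] b_def)
    also have "\<dots> = (\<Sum>S\<in>?F. b m S * character \<rho> S A)"
    proof (rule sum.mono_neutral_left[OF finF])
      have "monomial_degree m \<le> total_degree \<psi>"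
        using m by (auto simp: total_degree_def intro!: Max_ge)
      moreover have "Poly_Mapping.keys m \<subseteq> E"
        using m assms(4) by (auto simp: poly_vars_def)
      ultimately show "Pow (Poly_Mapping.keys m) \<subseteq> ?F"
        using card_keys_le_monomial_degree[of m]
        by (auto intro: order_trans[OF card_mono[OF finite_keys]])
    qed (auto simp: b_def)
    finally show ?thesis .
  qed
  show "eval_poly \<psi> = (\<lambda>A. \<Sum>S\<in>?F. c S * character \<rho> S A)"
  proof
    fix A
    have "eval_poly \<psi> A = (\<Sum>m\<in>Poly_Mapping.keys \<psi>. \<Sum>S\<in>?F.
        Poly_Mapping.lookup \<psi> m * b m S * character \<rho> S A)"
      by (simp add: eval_poly_def mono sum_distrib_left mult.assoc)
    also have "\<dots> = (\<Sum>S\<in>?F. c S * character \<rho> S A)"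
      by (subst sum.swap) (simp add: c_def sum_distrib_right)
    finally show "eval_poly \<psi> A = (\<Sum>S\<in>?F. c S * character \<rho> S A)" .
  qed
qed

section \<open>Reduction to planted expectations of characters\<close>

lemma finite_set_pmf_P0 [simp]: "finite (set_pmf (P0 n T \<rho>))"
  unfolding P0_def by (intro finite_set_Pi_pmf finite_entries)

lemma P1_eq:
  "P1 n T \<rho> = bind_pmf (pmf_of_set (balanced n)) (\<lambda>\<sigma>. bind_pmf (pmf_of_set (balanced T)) (\<lambda>\<tau>.
     Pi_pmf (entries n T) False (\<lambda>(i, j, t). bernoulli_pmf (block_prob \<rho> (\<tau> t) (\<sigma> i) (\<sigma> j)))))"
  by (simp add: P1_def P1_joint_def map_bind_pmf pmf.map_comp comp_def)

lemma finite_set_pmf_P1 [simp]: "finite (set_pmf (P1 n T \<rho>))"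
  by (auto simp: P1_eq intro!: finite_set_Pi_pmf)

text \<open>By orthonormality the second moment under the null law is the sum of the squared
  coefficients, while the planted expectation is linear in them. Cauchy-Schwarz separates the two,
  and the remaining sum is grouped by cardinality.\<close>

lemma square_expectation_P1_le:
  assumes "0 < \<rho>" "\<rho> < 1" "poly_vars \<psi> \<subseteq> entries n T"
  shows "(measure_pmf.expectation (P1 n T \<rho>) (eval_poly \<psi>))\<^sup>2 \<le>
           measure_pmf.expectation (P0 n T \<rho>) (\<lambda>A. (eval_poly \<psi> A)\<^sup>2) *
           (\<Sum>d\<le>total_degree \<psi>. \<Sum>S | S \<subseteq> entries n T \<and> card S = d.
              (measure_pmf.expectation (P1 n T \<rho>) (character \<rho> S))\<^sup>2)"
proof -
  let ?E = "entries n T"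
  let ?F = "{S. S \<subseteq> ?E \<and> card S \<le> total_degree \<psi>}"
  let ?L = "\<lambda>S. measure_pmf.expectation (P1 n T \<rho>) (character \<rho> S)"
  have finF: "finite ?F" by simp
  obtain c where c: "eval_poly \<psi> = (\<lambda>A. \<Sum>S\<in>?F. c S * character \<rho> S A)"
    using eval_poly_eq_sum_character[OF assms(1,2) finite_entries assms(3)] by blast
  have "measure_pmf.expectation (P0 n T \<rho>) (\<lambda>A. (eval_poly \<psi> A)\<^sup>2) =
      (\<Sum>S\<in>?F. \<Sum>S'\<in>?F. c S * c S' *
        measure_pmf.expectation (P0 n T \<rho>) (\<lambda>A. character \<rho> S A * character \<rho> S' A))"
  proof -
    have "(\<lambda>A. (eval_poly \<psi> A)\<^sup>2) =
        (\<lambda>A. \<Sum>S\<in>?F. \<Sum>S'\<in>?F. c S * c S' * (character \<rho> S A * character \<rho> S' A))"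
      unfolding c power2_eq_square sum_product by (simp only: mult_ac)
    then show ?thesis
      by (simp only: Bochner_Integration.integral_sum integrable_measure_pmf_finite
          finite_set_pmf_P0 integral_mult_right_zero)
  qed
  also have "\<dots> = (\<Sum>S\<in>?F. \<Sum>S'\<in>?F. if S = S' then c S * c S' else 0)"
    unfolding P0_def
    by (intro sum.cong refl) (simp add: character_orthonormal[OF assms(1,2) finite_entries])
  also have "\<dots> = (\<Sum>S\<in>?F. (c S)\<^sup>2)"
    using finF by (simp add: power2_eq_square)
  finally have norm: "measure_pmf.expectation (P0 n T \<rho>) (\<lambda>A. (eval_poly \<psi> A)\<^sup>2) =
      (\<Sum>S\<in>?F. (c S)\<^sup>2)" .
  have "measure_pmf.expectation (P1 n T \<rho>) (eval_poly \<psi>) = (\<Sum>S\<in>?F. c S * ?L S)"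
    by (simp add: c integrable_measure_pmf_finite Bochner_Integration.integral_sum)
  then have "(measure_pmf.expectation (P1 n T \<rho>) (eval_poly \<psi>))\<^sup>2 \<le>
      (\<Sum>S\<in>?F. (c S)\<^sup>2) * (\<Sum>S\<in>?F. (?L S)\<^sup>2)"
    by (simp add: Cauchy_Schwarz_ineq_sum)
  also have "(\<Sum>S\<in>?F. (?L S)\<^sup>2) =
      (\<Sum>d\<le>total_degree \<psi>. \<Sum>S\<in>{S \<in> ?F. card S = d}. (?L S)\<^sup>2)"
    by (rule sum.group[symmetric]) auto
  also have "\<dots> = (\<Sum>d\<le>total_degree \<psi>. \<Sum>S | S \<subseteq> ?E \<and> card S = d. (?L S)\<^sup>2)"
    by (intro sum.cong refl) auto
  finally show ?thesis
    by (simp add: norm)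
qed

section \<open>Planted expectations of characters\<close>

text \<open>The planted law becomes an average over the finite set of label pairs, on which
  \<open>replica_bound\<close> can act.\<close>

lemma expectation_P1:
  fixes f :: "tensor \<Rightarrow> real"
  shows "measure_pmf.expectation (P1 n T \<rho>) f =
     (\<Sum>(\<sigma>, \<tau>)\<in>balanced n \<times> balanced T. measure_pmf.expectation (Pi_pmf (entries n T) False
        (\<lambda>(i, j, t). bernoulli_pmf (block_prob \<rho> (\<tau> t) (\<sigma> i) (\<sigma> j)))) f) /
     card (balanced n \<times> balanced T)"
  by (simp add: P1_eq pmf_expectation_bind_pmf_of_set finite_set_Pi_pmf card_cartesian_product
      sum.cartesian_product[symmetric] divide_inverse sum_distrib_left sum_distrib_right mult_ac)

text \<open>The sign of the planted bias: for labels 0 and 1, the success probability of an entry is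
  \<open>\<rho>\<close> plus \<open>\<rho> / 2\<close> times this weight. Both labellings form one
  hidden variable.\<close>

definition spin_weight :: "entry \<Rightarrow> (nat \<Rightarrow> nat) \<times> (nat \<Rightarrow> nat) \<Rightarrow> real" where
  "spin_weight = (\<lambda>(i, j, t) (\<sigma>, \<tau>). spin (\<sigma> i) * spin (\<sigma> j) * spin (\<tau> t))"

text \<open>Given the labels the entries are independent, so each entry in \<open>S\<close>
  contributes its standardised mean shift, of size
  \<open>\<rho> / (2 * bernoulli_scale \<rho>)\<close>, and every other entry contributes 1.\<close>

lemma expectation_P1_character:
  assumes "0 < \<rho>" "\<rho> < 2/3" "S \<subseteq> entries n T"
  shows "measure_pmf.expectation (P1 n T \<rho>) (character \<rho> S) =
    (\<rho> / (2 * bernoulli_scale \<rho>)) ^ card S *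
    (\<Sum>\<omega>\<in>balanced n \<times> balanced T. \<Prod>e\<in>S. spin_weight e \<omega>) / card (balanced n \<times> balanced T)"
proof -
  let ?q = "bernoulli_scale \<rho>"
  have "measure_pmf.expectation (Pi_pmf (entries n T) False
        (\<lambda>(i, j, t). bernoulli_pmf (block_prob \<rho> (\<tau> t) (\<sigma> i) (\<sigma> j)))) (character \<rho> S) =
      (\<rho> / (2 * ?q)) ^ card S * (\<Prod>e\<in>S. spin_weight e (\<sigma>, \<tau>))"
    if \<sigma>: "\<sigma> \<in> balanced n" and \<tau>: "\<tau> \<in> balanced T" for \<sigma> \<tau>
  proof -
    define g where "g e b = (if e \<in> S then (of_bool b - \<rho>) / ?q else 1)" for e :: entry and b
    let ?p = "\<lambda>(i, j, t). bernoulli_pmf (block_prob \<rho> (\<tau> t) (\<sigma> i) (\<sigma> j))"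
    have "measure_pmf.expectation (Pi_pmf (entries n T) False ?p) (character \<rho> S) =
        (\<Prod>e\<in>entries n T. measure_pmf.expectation (?p e) (g e))"
    proof -
      have "character \<rho> S = (\<lambda>A. \<Prod>e\<in>entries n T. g e (A e))"
        unfolding g_def by (intro ext character_restrict[OF finite_entries assms(3)])
      then show ?thesis
        by (simp only: expectation_prod_Pi_pmf_signed[OF finite_entries])
    qed
    also have "\<dots> = (\<Prod>e\<in>entries n T. if e \<in> S then \<rho> / (2 * ?q) * spin_weight e (\<sigma>, \<tau>) else 1)"
    proof (intro prod.cong refl)
      fix e assume e: "e \<in> entries n T"
      obtain i j t where ijt: "e = (i, j, t)" by (cases e)
      then have "i \<in> {1..n}" "j \<in> {1..n}" "t \<in> {1..T}"
        using e by (auto simp: entries_def)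
      then have labels: "\<sigma> i = 0 \<or> \<sigma> i = 1" "\<sigma> j = 0 \<or> \<sigma> j = 1" "\<tau> t = 0 \<or> \<tau> t = 1"
        using balanced_label[OF \<sigma>] balanced_label[OF \<tau>] by blast+
      define r where "r = block_prob \<rho> (\<tau> t) (\<sigma> i) (\<sigma> j)"
      \<comment> \<open>The bound \<open>\<rho> < 2/3\<close> keeps the larger probability
        \<open>3/2 * \<rho>\<close> below 1.\<close>
      have r: "0 \<le> r" "r \<le> 1"
        using assms(1,2) by (auto simp: r_def block_prob_def)
      have dev: "r - \<rho> = \<rho> / 2 * spin_weight e (\<sigma>, \<tau>)"
        using labels by (auto simp: r_def ijt spin_weight_def block_prob_def spin_def)
      have *: "(r - \<rho>) / ?q = \<rho> / (2 * ?q) * spin_weight e (\<sigma>, \<tau>)"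
        unfolding dev by simp
      have "measure_pmf.expectation (?p e) (g e) = g e True * r + g e False * (1 - r)"
        using r by (simp add: ijt r_def)
      also have "\<dots> = (if e \<in> S then (r - \<rho>) / ?q else 1)"
        by (simp add: g_def algebra_simps diff_divide_distrib)
      finally show "measure_pmf.expectation (?p e) (g e) =
          (if e \<in> S then \<rho> / (2 * ?q) * spin_weight e (\<sigma>, \<tau>) else 1)"
        using * by simp
    qed
    also have "\<dots> = (\<Prod>e\<in>S. \<rho> / (2 * ?q) * spin_weight e (\<sigma>, \<tau>))"
      using assms(3) by (simp add: prod.inter_restrict[symmetric] Int_absorb1)
    finally show ?thesis
      by (simp only: prod.distrib prod_constant)
  qed
  then show ?thesis
    unfolding expectation_P1 sum_distrib_left
    by (intro arg_cong2[where f = "(/)"] refl sum.cong) auto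
qed

section \<open>Moments of the replica kernel\<close>

text \<open>The square of the sum of the \<open>u i\<close> consists of \<open>n\<close> diagonal
  terms equal to 1 and twice the sum over pairs \<open>i < j\<close>.\<close>

lemma sum_entries:
  fixes u v :: "nat \<Rightarrow> real"
  assumes "\<And>i. u i * u i = 1"
  shows "(\<Sum>(i, j, t)\<in>entries n T. u i * u j * v t) =
           ((\<Sum>i\<in>{1..n}. u i)\<^sup>2 - n) / 2 * (\<Sum>t\<in>{1..T}. v t)"
proof (induction n)
  case 0
  have "entries 0 T = {}" by (auto simp: entries_def)
  then show ?case by simp
next
  case (Suc n)
  \<comment> \<open>The entries whose larger vertex is the new one.\<close>
  let ?N = "(\<lambda>(i, t). (i, Suc n, t)) ` ({1..n} \<times> {1..T})"
  have "entries (Suc n) T = entries n T \<union> ?N"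
    by (auto simp: entries_def image_iff)
  moreover have "entries n T \<inter> ?N = {}"
    by (auto simp: entries_def)
  ultimately have "(\<Sum>(i, j, t)\<in>entries (Suc n) T. u i * u j * v t) =
      (\<Sum>(i, j, t)\<in>entries n T. u i * u j * v t) + (\<Sum>(i, j, t)\<in>?N. u i * u j * v t)"
    by (simp add: sum.union_disjoint)
  also have "(\<Sum>(i, j, t)\<in>?N. u i * u j * v t) =
      (\<Sum>(i, t)\<in>{1..n} \<times> {1..T}. u i * u (Suc n) * v t)"
    by (subst sum.reindex) (auto simp: inj_on_def case_prod_beta intro!: sum.cong)
  also have "\<dots> = (\<Sum>i\<in>{1..n}. u i * u (Suc n)) * (\<Sum>t\<in>{1..T}. v t)"
    by (simp only: sum_product sum.cartesian_product)
  also have "(\<Sum>i\<in>{1..n}. u i * u (Suc n)) = u (Suc n) * (\<Sum>i\<in>{1..n}. u i)"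
    by (simp add: sum_distrib_left mult.commute)
  finally have *: "(\<Sum>(i, j, t)\<in>entries (Suc n) T. u i * u j * v t) =
      (((\<Sum>i\<in>{1..n}. u i)\<^sup>2 - n) / 2 + u (Suc n) * (\<Sum>i\<in>{1..n}. u i)) * (\<Sum>t\<in>{1..T}. v t)"
    using Suc.IH by (simp add: algebra_simps)
  have "(\<Sum>i\<in>{1..Suc n}. u i)\<^sup>2 = ((\<Sum>i\<in>{1..n}. u i) + u (Suc n))\<^sup>2"
    by simp
  also have "\<dots> = (\<Sum>i\<in>{1..n}. u i)\<^sup>2 + 2 * u (Suc n) * (\<Sum>i\<in>{1..n}. u i) + 1"
    using assms[of "Suc n"] by (simp add: power2_eq_square algebra_simps)
  finally show ?case
    unfolding * by (simp add: field_simps)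
qed

text \<open>At each entry the product of the weights of two replicas splits again over the two
  vertices and the layer, so \<open>sum_entries\<close> applies to the products of spins.\<close>

lemma sum_spin_weight:
  "(\<Sum>e\<in>entries n T. spin_weight e (\<sigma>, \<tau>) * spin_weight e (\<sigma>', \<tau>')) =
     ((overlap n \<sigma> \<sigma>')\<^sup>2 - n) / 2 * overlap T \<tau> \<tau>'"
proof -
  have "(\<Sum>e\<in>entries n T. spin_weight e (\<sigma>, \<tau>) * spin_weight e (\<sigma>', \<tau>')) =
      (\<Sum>(i, j, t)\<in>entries n T. (spin (\<sigma> i) * spin (\<sigma>' i)) * (spin (\<sigma> j) * spin (\<sigma>' j)) *
        (spin (\<tau> t) * spin (\<tau>' t)))"
    by (intro sum.cong refl) (auto simp: spin_weight_def)
  also have "\<dots> = ((overlap n \<sigma> \<sigma>')\<^sup>2 - n) / 2 * overlap T \<tau> \<tau>'"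
    unfolding overlap_def by (rule sum_entries) (simp add: spin_def)
  finally show ?thesis .
qed

text \<open>The centred square is at most the larger of \<open>X\<^sup>2\<close> and
  \<open>n\<close> in absolute value, \<open>X\<close> being the overlap. So its \<open>d\<close>-th
  moment is controlled by the moment of \<open>X\<close> of order \<open>2 * d\<close> and by
  \<open>n ^ d\<close>.\<close>

lemma sum_overlap_centred_moment_le:
  assumes "even n" "0 < n" "0 < d"
  shows "(\<Sum>\<sigma>\<in>balanced n. \<Sum>\<sigma>'\<in>balanced n. \<bar>((overlap n \<sigma> \<sigma>')\<^sup>2 - n) / 2\<bar> ^ d)
           \<le> (card (balanced n))\<^sup>2 * (3 * ((exp 1)\<^sup>2 * d * n) ^ d)"
proof -
  let ?B = "balanced n"
  have "\<bar>((overlap n \<sigma> \<sigma>')\<^sup>2 - n) / 2\<bar> ^ d \<le> (\<bar>overlap n \<sigma> \<sigma>'\<bar> ^ (2 * d) + real n ^ d) / 2 ^ d" for \<sigma> \<sigma>'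
  proof -
    let ?X = "(overlap n \<sigma> \<sigma>')\<^sup>2"
    have "0 \<le> ?X" "0 \<le> real n"
      by simp_all
    then have "\<bar>?X - n\<bar> \<le> max ?X n"
      by linarith
    then have "\<bar>?X - n\<bar> ^ d \<le> max ?X n ^ d"
      by (intro power_mono) auto
    also have "\<dots> \<le> ?X ^ d + real n ^ d"
      by (auto simp: max_def)
    also have "?X ^ d = \<bar>overlap n \<sigma> \<sigma>'\<bar> ^ (2 * d)"
      by (simp add: power_mult)
    finally show ?thesis
      by (simp add: power_divide divide_right_mono)
  qed
  then have "(\<Sum>\<sigma>\<in>?B. \<Sum>\<sigma>'\<in>?B. \<bar>((overlap n \<sigma> \<sigma>')\<^sup>2 - n) / 2\<bar> ^ d) \<le>
      (\<Sum>\<sigma>\<in>?B. \<Sum>\<sigma>'\<in>?B. (\<bar>overlap n \<sigma> \<sigma>'\<bar> ^ (2 * d) + real n ^ d) / 2 ^ d)"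
    by (intro sum_mono)
  also have "\<dots> = ((\<Sum>\<sigma>\<in>?B. \<Sum>\<sigma>'\<in>?B. \<bar>overlap n \<sigma> \<sigma>'\<bar> ^ (2 * d)) +
      (card ?B)\<^sup>2 * real n ^ d) / 2 ^ d"
    by (simp add: sum.distrib power2_eq_square flip: sum_divide_distrib)
  also have "\<dots> \<le> ((card ?B)\<^sup>2 * (2 * (exp 1 * sqrt (real (2 * d) * n)) ^ (2 * d)) +
      (card ?B)\<^sup>2 * real n ^ d) / 2 ^ d"
    using assms by (intro divide_right_mono add_right_mono sum_overlap_moment_le) auto
  also have "(exp 1 * sqrt (real (2 * d) * n)) ^ (2 * d) = ((exp 1)\<^sup>2 * (2 * d * n)) ^ d"
    by (simp add: power_mult power_mult_distrib)
  \<comment> \<open>The term from centring is absorbed into the main one, whence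
    \<open>2 + 1 = 3\<close>; the inner factor 2 cancels against \<open>2 ^ d\<close>.\<close>
  also have "real n ^ d \<le> ((exp 1)\<^sup>2 * (2 * d * n)) ^ d"
  proof (rule power_mono)
    have "(1::real) * n \<le> ((exp 1)\<^sup>2 * (2 * d)) * real n"
      using assms(3) by (intro mult_right_mono) (auto intro!: mult_ge1_I one_le_power)
    then show "real n \<le> (exp 1)\<^sup>2 * (2 * d * n)"
      by (simp add: mult_ac)
  qed simp
  finally show ?thesis
    by (simp add: power_mult_distrib field_simps)
qed

text \<open>The kernel is a function of the vertex labels times a function of the layer labels, so
  after taking absolute values, needed for odd \<open>d\<close>, the sum factorises. The constants
  are \<open>6 = 3 * 2\<close> and \<open>exp 3 = (exp 1)\<^sup>2 * exp 1\<close>.\<close>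

lemma sum_spin_weight_moment_le:
  assumes "even n" "0 < n" "even T" "0 < T" "0 < d"
  defines "\<Omega> \<equiv> balanced n \<times> balanced T"
  shows "(\<Sum>\<omega>\<in>\<Omega>. \<Sum>\<omega>'\<in>\<Omega>. (\<Sum>e\<in>entries n T. spin_weight e \<omega> * spin_weight e \<omega>') ^ d)
           \<le> (card \<Omega>)\<^sup>2 * (6 * (exp 3 * d * n * sqrt (d * T)) ^ d)"
proof -
  let ?f = "\<lambda>\<sigma> \<sigma>'. \<bar>((overlap n \<sigma> \<sigma>')\<^sup>2 - n) / 2\<bar> ^ d"
  let ?g = "\<lambda>\<tau> \<tau>'. \<bar>overlap T \<tau> \<tau>'\<bar> ^ d"
  have "(\<Sum>\<omega>\<in>\<Omega>. \<Sum>\<omega>'\<in>\<Omega>. (\<Sum>e\<in>entries n T. spin_weight e \<omega> * spin_weight e \<omega>') ^ d) \<le>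
      (\<Sum>\<omega>\<in>\<Omega>. \<Sum>\<omega>'\<in>\<Omega>. ?f (fst \<omega>) (fst \<omega>') * ?g (snd \<omega>) (snd \<omega>'))"
  proof (intro sum_mono)
    fix \<omega> \<omega>' :: "(nat \<Rightarrow> nat) \<times> (nat \<Rightarrow> nat)"
    have "(\<Sum>e\<in>entries n T. spin_weight e \<omega> * spin_weight e \<omega>') ^ d \<le>
        \<bar>\<Sum>e\<in>entries n T. spin_weight e \<omega> * spin_weight e \<omega>'\<bar> ^ d"
      by (rule order_trans[OF abs_ge_self]) (simp only: power_abs order_refl)
    also have "\<dots> = ?f (fst \<omega>) (fst \<omega>') * ?g (snd \<omega>) (snd \<omega>')"
      using sum_spin_weight[where n = n and T = T and \<sigma> = "fst \<omega>" and \<tau> = "snd \<omega>"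
          and \<sigma>' = "fst \<omega>'" and \<tau>' = "snd \<omega>'"]
      by (simp only: prod.collapse abs_mult power_mult_distrib)
    finally show "(\<Sum>e\<in>entries n T. spin_weight e \<omega> * spin_weight e \<omega>') ^ d \<le>
      ?f (fst \<omega>) (fst \<omega>') * ?g (snd \<omega>) (snd \<omega>')" .
  qed
  also have "\<dots> = (\<Sum>\<sigma>\<in>balanced n. \<Sum>\<tau>\<in>balanced T. \<Sum>\<sigma>'\<in>balanced n. \<Sum>\<tau>'\<in>balanced T.
      ?f \<sigma> \<sigma>' * ?g \<tau> \<tau>')"
    by (simp add: \<Omega>_def sum.cartesian_product')
  also have "\<dots> = (\<Sum>\<sigma>\<in>balanced n. \<Sum>\<sigma>'\<in>balanced n. ?f \<sigma> \<sigma>') *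
      (\<Sum>\<tau>\<in>balanced T. \<Sum>\<tau>'\<in>balanced T. ?g \<tau> \<tau>')"
    by (simp only: sum_product)
  also have "\<dots> \<le> ((card (balanced n))\<^sup>2 * (3 * ((exp 1)\<^sup>2 * d * n) ^ d)) *
      ((card (balanced T))\<^sup>2 * (2 * (exp 1 * sqrt (d * T)) ^ d))"
    using sum_overlap_centred_moment_le[OF assms(1,2,5)] sum_overlap_moment_le[OF assms(3,4,5)]
    by (intro mult_mono) (auto intro!: sum_nonneg)
  also have "\<dots> = (card \<Omega>)\<^sup>2 * (6 * ((exp 1)\<^sup>2 * exp 1 * d * n * sqrt (d * T)) ^ d)"
    by (simp add: \<Omega>_def card_cartesian_product power_mult_distrib mult_ac)
  also have "(exp 1)\<^sup>2 * exp 1 = exp (3::real)"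
    by (simp add: power2_eq_square flip: exp_add)
  finally show ?thesis
    by (simp only: of_nat_mult)
qed

text \<open>The replica bound with constant weight is combined with the kernel moments. Dividing by
  \<open>fact d\<close> removes the factor \<open>d ^ d\<close> from the moments at the cost of
  \<open>exp 1 ^ d\<close>, so that only \<open>sqrt d\<close> is left in the base.\<close>

lemma sum_square_expectation_P1_character_le:
  assumes "even n" "0 < n" "even T" "0 < T" "0 < d" "0 < \<rho>" "\<rho> \<le> 1/2"
  shows "(\<Sum>S | S \<subseteq> entries n T \<and> card S = d.
            (measure_pmf.expectation (P1 n T \<rho>) (character \<rho> S))\<^sup>2)
           \<le> 6 * (exp 4 / 2 * \<rho> * n * sqrt (d * T)) ^ d"
proof -
  define \<Omega> where "\<Omega> = balanced n \<times> balanced T"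
  \<comment> \<open>The standardised mean shift of one entry; its square is at most
    \<open>\<rho> / 2\<close> since \<open>\<rho> \<le> 1/2\<close>.\<close>
  define l where "l = \<rho> / (2 * bernoulli_scale \<rho>)"
  define M where "M = exp 3 * d * n * sqrt (d * T)"
  define W where "W = (\<Sum>S | S \<subseteq> entries n T \<and> card S = d.
    (\<Sum>\<omega>\<in>\<Omega>. \<Prod>e\<in>S. spin_weight e \<omega>)\<^sup>2)"
  have fin: "finite \<Omega>" by (simp add: \<Omega>_def)
  have card: "0 < real (card \<Omega>)"
    by (simp add: \<Omega>_def card_cartesian_product)
  have "(bernoulli_scale \<rho>)\<^sup>2 = \<rho> * (1 - \<rho>)"
    using assms(6,7) by (simp add: power2_eq_square bernoulli_scale_square)
  then have "l\<^sup>2 = \<rho> / (4 * (1 - \<rho>))"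
    using assms(6,7) by (simp add: l_def power_divide power_mult_distrib power2_eq_square)
  also have "\<dots> \<le> \<rho> / (4 * (1/2))"
    using assms(6,7) by (intro divide_left_mono mult_left_mono) auto
  finally have l: "l\<^sup>2 \<le> \<rho> / 2" by simp
  have M: "0 \<le> M" by (simp add: M_def)
  have dd: "real d ^ d / fact d \<le> exp 1 ^ d"
    using power_le_fact_mult_exp[of "real d" d]
    by (simp add: divide_le_eq mult_ac flip: exp_of_nat_mult)
  have "fact d * W \<le> (card \<Omega>)\<^sup>2 * (6 * M ^ d)"
    using replica_bound[OF finite_entries[of n T] fin, where d = d and h = "\<lambda>_. 1" and w = spin_weight]
      sum_spin_weight_moment_le[OF assms(1-5)]
    by (simp add: W_def M_def \<Omega>_def)
  then have W: "W / (card \<Omega>)\<^sup>2 \<le> 6 * M ^ d / fact d"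
    using card by (simp add: field_simps)
  have "(\<Sum>S | S \<subseteq> entries n T \<and> card S = d.
      (measure_pmf.expectation (P1 n T \<rho>) (character \<rho> S))\<^sup>2) =
      (\<Sum>S | S \<subseteq> entries n T \<and> card S = d. (l\<^sup>2) ^ d *
        (\<Sum>\<omega>\<in>\<Omega>. \<Prod>e\<in>S. spin_weight e \<omega>)\<^sup>2 / (card \<Omega>)\<^sup>2)"
  proof (intro sum.cong refl)
    fix S assume S: "S \<in> {S. S \<subseteq> entries n T \<and> card S = d}"
    have "measure_pmf.expectation (P1 n T \<rho>) (character \<rho> S) =
        l ^ d * (\<Sum>\<omega>\<in>\<Omega>. \<Prod>e\<in>S. spin_weight e \<omega>) / card \<Omega>"
      using S assms(6,7) by (simp add: expectation_P1_character l_def \<Omega>_def)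
    then show "(measure_pmf.expectation (P1 n T \<rho>) (character \<rho> S))\<^sup>2 = (l\<^sup>2) ^ d *
        (\<Sum>\<omega>\<in>\<Omega>. \<Prod>e\<in>S. spin_weight e \<omega>)\<^sup>2 / (card \<Omega>)\<^sup>2"
      by (simp add: power_divide power_mult_distrib power2_eq_square)
  qed
  also have "\<dots> = (l\<^sup>2) ^ d * (W / (card \<Omega>)\<^sup>2)"
    by (simp add: W_def sum_distrib_left sum_divide_distrib)
  also have "\<dots> \<le> (\<rho> / 2) ^ d * (6 * M ^ d / fact d)"
    using l W M assms(6) by (intro mult_mono power_mono) (auto simp: W_def intro!: divide_nonneg_nonneg sum_nonneg)
  also have "\<dots> = 6 * (\<rho> / 2 * exp 3 * n * sqrt (d * T)) ^ d * (real d ^ d / fact d)"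
    by (simp add: M_def power_mult_distrib power_divide mult_ac)
  also have "\<dots> \<le> 6 * (\<rho> / 2 * exp 3 * n * sqrt (d * T)) ^ d * exp 1 ^ d"
    using assms(6) by (intro mult_left_mono dd) auto
  also have "\<dots> = 6 * (exp 3 * exp 1 / 2 * \<rho> * n * sqrt (d * T)) ^ d"
    by (simp add: power_mult_distrib power_divide mult_ac)
  also have "exp 3 * exp 1 = exp (4::real)"
    by (simp flip: exp_add)
  finally show ?thesis .
qed

section \<open>Uniform bound and conclusion\<close>

text \<open>The base of the bound increases with \<open>d\<close>, so its smallness at the total
  degree covers all smaller \<open>d\<close>. The parts are then dominated by a geometric series
  with sum below 12, and \<open>12 \<le> 4\<^sup>2\<close>.\<close>

lemma expectation_P1_bounded:
  assumes "even n" "0 < n" "even T" "0 < T" "0 < \<rho>" "\<rho> \<le> 1/2"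
    and "poly_vars \<psi> \<subseteq> entries n T"
    and "exp 4 / 2 * \<rho> * n * sqrt (total_degree \<psi> * T) \<le> 1/2"
    and "measure_pmf.expectation (P0 n T \<rho>) (\<lambda>A. (eval_poly \<psi> A)\<^sup>2) = 1"
  shows "\<bar>measure_pmf.expectation (P1 n T \<rho>) (eval_poly \<psi>)\<bar> \<le> 4"
proof -
  let ?a = "\<lambda>d. \<Sum>S | S \<subseteq> entries n T \<and> card S = d.
    (measure_pmf.expectation (P1 n T \<rho>) (character \<rho> S))\<^sup>2"
  have a: "?a d \<le> 6 * (1/2) ^ d" if d: "d \<le> total_degree \<psi>" for d
  proof (cases "d = 0")
    case True
    \<comment> \<open>Only the constant character occurs here, contributing 1.\<close>
    have "{S. S \<subseteq> entries n T \<and> card S = 0} = {{}}"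
      by (auto simp: card_eq_0_iff dest: finite_subset)
    moreover have "character \<rho> {} = (\<lambda>A :: tensor. 1)"
      by (simp add: character_def fun_eq_iff)
    ultimately show ?thesis
      using True by simp
  next
    case False
    have "exp 4 / 2 * \<rho> * n * sqrt (d * T) \<le> exp 4 / 2 * \<rho> * n * sqrt (total_degree \<psi> * T)"
      using d assms(5) by (intro mult_left_mono) (auto intro!: mult_right_mono)
    then have "exp 4 / 2 * \<rho> * n * sqrt (d * T) \<le> 1/2"
      using assms(8) by linarith
    then have "(exp 4 / 2 * \<rho> * n * sqrt (d * T)) ^ d \<le> (1/2) ^ d"
      using assms(5) by (intro power_mono) auto
    then show ?thesis
      using sum_square_expectation_P1_character_le[OF assms(1-4) _ assms(5,6), of d] False
      by simp
  qed
  have "(measure_pmf.expectation (P1 n T \<rho>) (eval_poly \<psi>))\<^sup>2 \<le> (\<Sum>d\<le>total_degree \<psi>. ?a d)"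
    using square_expectation_P1_le[OF assms(5) _ assms(7)] assms(6,9) by simp
  also have "\<dots> \<le> (\<Sum>d\<le>total_degree \<psi>. 6 * (1/2) ^ d)"
    by (intro sum_mono a) simp
  also have "\<dots> = 6 * (\<Sum>d<Suc (total_degree \<psi>). (1/2) ^ d)"
    by (simp only: sum_distrib_left lessThan_Suc_atMost)
  also have "\<dots> \<le> 12"
    by (subst sum_gp_strict) simp
  also have "\<dots> \<le> 4\<^sup>2"
    by simp
  finally have "\<bar>measure_pmf.expectation (P1 n T \<rho>) (eval_poly \<psi>)\<bar>\<^sup>2 \<le> 4\<^sup>2"
    by simp
  then show ?thesis
    by (rule power2_le_imp_le) simp
qed

text \<open>For degree up to \<open>ln n powr 1.01\<close> the base is of order
  \<open>ln n powr (-1.4 + 0.505)\<close>, which tends to 0; the bound 4 then holds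
  eventually.\<close>

lemma low_degree_boundedI:
  assumes "admissible T \<rho>"
    and "\<forall>\<^sub>F n in even_at_top.
           real n * real (T n) powr (1/2) * \<rho> n \<le> 1/2 * ln (real n) powr (- 1.4)"
  shows "low_degree_bounded T \<rho>"
  unfolding low_degree_bounded_def
proof (intro exI)
  \<comment> \<open>The constant \<open>exp 4 / 4\<close> is \<open>exp 4 / 2\<close> times the
    \<open>1/2\<close> of the hypothesis. The limit is proved along all \<open>n\<close> and then
    restricted to even ones.\<close>
  have "\<forall>\<^sub>F n in sequentially. exp 4 / 4 * ln (real n) powr (-1.4) * sqrt (ln (real n) powr 1.01) \<le> 1/2"
    by real_asymp
  then have log: "\<forall>\<^sub>F n in even_at_top.
      exp 4 / 4 * ln (real n) powr (-1.4) * sqrt (ln (real n) powr 1.01) \<le> 1/2"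
    unfolding even_at_top_def by (rule filter_leD[OF inf_le1])
  have "\<forall>\<^sub>F n in sequentially. 0 < n"
    by (rule eventually_gt_at_top)
  then have pos: "\<forall>\<^sub>F n in even_at_top. 0 < n"
    unfolding even_at_top_def by (rule filter_leD[OF inf_le1])
  have even: "\<forall>\<^sub>F n in even_at_top. even n"
    unfolding even_at_top_def by (rule filter_leD[OF inf_le2]) (simp add: eventually_principal)
  have small: "\<forall>\<^sub>F n in even_at_top. \<rho> n < 1/2"
    using assms(1) by (intro order_tendstoD(2)[of \<rho> 0]) (auto simp: admissible_def)
  show "\<forall>\<^sub>F n in even_at_top. \<forall>\<psi>.
      poly_vars \<psi> \<subseteq> entries n (T n) \<and>
      real (total_degree \<psi>) \<le> ln (real n) powr 1.01 \<and>
      measure_pmf.expectation (P0 n (T n) (\<rho> n)) (\<lambda>A. (eval_poly \<psi> A)\<^sup>2) = 1 \<and>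
      measure_pmf.expectation (P0 n (T n) (\<rho> n)) (eval_poly \<psi>) = 0 \<longrightarrow>
      \<bar>measure_pmf.expectation (P1 n (T n) (\<rho> n)) (eval_poly \<psi>)\<bar> \<le> 4"
    using log pos even small assms(2)
  proof eventually_elim
    case (elim n)
    have adm: "even (T n)" "0 < T n" "0 < \<rho> n"
      using assms(1) elim by (auto simp: admissible_def)
    show ?case
    proof (intro allI impI, elim conjE)
      fix \<psi>
      assume vars: "poly_vars \<psi> \<subseteq> entries n (T n)"
        and deg: "real (total_degree \<psi>) \<le> ln (real n) powr 1.01"
        and norm: "measure_pmf.expectation (P0 n (T n) (\<rho> n)) (\<lambda>A. (eval_poly \<psi> A)\<^sup>2) = 1"
      have "exp 4 / 2 * \<rho> n * n * sqrt (total_degree \<psi> * T n) =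
          exp 4 / 2 * (n * T n powr (1/2) * \<rho> n) * sqrt (total_degree \<psi>)"
        by (simp add: real_sqrt_mult powr_half_sqrt mult_ac)
      also have "\<dots> \<le> exp 4 / 2 * (1/2 * ln (real n) powr (-1.4)) * sqrt (ln (real n) powr 1.01)"
        by (intro mult_mono[OF mult_left_mono[OF elim(5)]]) (use deg in auto)
      also have "\<dots> \<le> 1/2"
        using elim(1) by simp
      finally show "\<bar>measure_pmf.expectation (P1 n (T n) (\<rho> n)) (eval_poly \<psi>)\<bar> \<le> 4"
        using elim adm by (intro expectation_P1_bounded vars norm) auto
    qed
  qed
qed

theorem theorem3p3:
  fixes T :: "nat \<Rightarrow> nat" and \<rho> :: "nat \<Rightarrow> real"
  assumes "admissible T \<rho>"
    and "low_degree_conjecture"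
    and "\<forall>\<^sub>F n in even_at_top.
           real n * real (T n) powr (1/2) * \<rho> n \<le> 1/2 * ln (real n) powr (- 1.4)"
  shows "\<not> poly_time_distinguishable T \<rho>"
  using assms low_degree_boundedI by (auto simp: low_degree_conjecture_def)

end
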